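(* Let $G$ be a cubic graph and let $P$ denote the Petersen graph. The following are equivalent: (i) the strong chromatic index of $G$ equals $5$; (ii) $G$ covers $P$; (iii) $G$ admits a normal $5$-edge-coloring in which every edge is rich; (iv) $G$ admits a Petersen coloring which is a homomorphism.
   Context: A strong edge coloring is a proper edge coloring with no bichromatic path of length three; the strong chromatic index is the minimum number of colors of such a coloring. $G$ covers $P$ if there is a surjective homomorphism $G\to P$ mapping the edges at each vertex $v$ bijectively onto the edges at the image of $v$. For a proper $5$-edge-coloring of a cubic graph, an edge $e$ is rich if the four edges adjacent to $e$ receive pairwise distinct colors (4 colors), and poor if they receive exactly $2$ colors; the coloring is normal if every edge is rich or poor (never exactly $3$ colors on the adjacent edges). A Petersen coloring of $G$ is a map $\xi\colon E(G)\to E(P)$ sending any two adjacent edges of $G$ to adjacent edges of $P$; then for each vertex $v$ of $G$ the three edges at $v$ are sent to the three edges at a single vertex of $P$, giving an induced map $V(G)\to V(P)$. The Petersen coloring is a homomorphism if this induced vertex map sends adjacent vertices of $G$ to adjacent vertices of $P$. *)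

theory Defs
  imports Main
begin

section \<open>Finite simple graphs\<close>

record 'a ugraph =
  verts :: "'a set"
  edges :: "'a set set"

definition simple_graph :: "'a ugraph \<Rightarrow> bool" where
  "simple_graph G \<longleftrightarrow> finite (verts G) \<and> verts G \<noteq> {} \<and>
     (\<forall>e\<in>edges G. e \<subseteq> verts G \<and> card e = 2)"

definition edges_at :: "'a ugraph \<Rightarrow> 'a \<Rightarrow> 'a set set" where
  "edges_at G v = {e \<in> edges G. v \<in> e}"

definition cubic_graph :: "'a ugraph \<Rightarrow> bool" where
  "cubic_graph G \<longleftrightarrow> simple_graph G \<and> (\<forall>v\<in>verts G. card (edges_at G v) = 3)"

definition adjacent_edges :: "'a ugraph \<Rightarrow> 'a set \<Rightarrow> 'a set set" where
  "adjacent_edges G e = {f \<in> edges G. f \<noteq> e \<and> f \<inter> e \<noteq> {}}"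

text \<open>The Petersen graph as the Kneser graph of the 2-subsets of a 5-set.\<close>

definition petersen_graph :: "nat set ugraph" where
  "petersen_graph =
     \<lparr> verts = {A. A \<subseteq> {..<5} \<and> card A = 2},
       edges = {{A, B} | A B. A \<subseteq> {..<5} \<and> card A = 2 \<and> B \<subseteq> {..<5} \<and> card B = 2 \<and> A \<inter> B = {}} \<rparr>"


section \<open>Strong edge colorings\<close>

text \<open>In the colorings below only the values on edges matter; \<open>k\<close> bounds the number of
  available colors, not all of which need be used.\<close>

definition proper_edge_coloring :: "'a ugraph \<Rightarrow> nat \<Rightarrow> ('a set \<Rightarrow> nat) \<Rightarrow> bool" where
  "proper_edge_coloring G k c \<longleftrightarrow> c ` edges G \<subseteq> {..<k} \<and>
     (\<forall>e\<in>edges G. \<forall>f\<in>adjacent_edges G e. c e \<noteq> c f)"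

definition bichromatic_path3 :: "'a ugraph \<Rightarrow> ('a set \<Rightarrow> nat) \<Rightarrow> 'a \<Rightarrow> 'a \<Rightarrow> 'a \<Rightarrow> 'a \<Rightarrow> bool" where
  "bichromatic_path3 G c u v w x \<longleftrightarrow> distinct [u, v, w, x] \<and>
     {u, v} \<in> edges G \<and> {v, w} \<in> edges G \<and> {w, x} \<in> edges G \<and>
     card {c {u, v}, c {v, w}, c {w, x}} = 2"

definition strong_edge_coloring :: "'a ugraph \<Rightarrow> nat \<Rightarrow> ('a set \<Rightarrow> nat) \<Rightarrow> bool" where
  "strong_edge_coloring G k c \<longleftrightarrow> proper_edge_coloring G k c \<and>
     \<not> (\<exists>u v w x. bichromatic_path3 G c u v w x)"

definition strong_chromatic_index :: "'a ugraph \<Rightarrow> nat" where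
  "strong_chromatic_index G = (LEAST k. \<exists>c. strong_edge_coloring G k c)"


section \<open>Covers\<close>

definition graph_hom :: "'a ugraph \<Rightarrow> 'b ugraph \<Rightarrow> ('a \<Rightarrow> 'b) \<Rightarrow> bool" where
  "graph_hom G H f \<longleftrightarrow> f ` verts G \<subseteq> verts H \<and>
     (\<forall>u v. {u, v} \<in> edges G \<longrightarrow> {f u, f v} \<in> edges H)"

definition covering_map :: "'a ugraph \<Rightarrow> 'b ugraph \<Rightarrow> ('a \<Rightarrow> 'b) \<Rightarrow> bool" where
  "covering_map G H f \<longleftrightarrow> graph_hom G H f \<and> f ` verts G = verts H \<and>
     (\<forall>v\<in>verts G. bij_betw (\<lambda>e. f ` e) (edges_at G v) (edges_at H (f v)))"

definition covers :: "'a ugraph \<Rightarrow> 'b ugraph \<Rightarrow> bool" where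
  "covers G H \<longleftrightarrow> (\<exists>f. covering_map G H f)"


section \<open>Normal colorings\<close>

definition rich_edge :: "'a ugraph \<Rightarrow> ('a set \<Rightarrow> nat) \<Rightarrow> 'a set \<Rightarrow> bool" where
  "rich_edge G c e \<longleftrightarrow> inj_on c (adjacent_edges G e)"

definition poor_edge :: "'a ugraph \<Rightarrow> ('a set \<Rightarrow> nat) \<Rightarrow> 'a set \<Rightarrow> bool" where
  "poor_edge G c e \<longleftrightarrow> card (c ` adjacent_edges G e) = 2"

definition normal_5_edge_coloring :: "'a ugraph \<Rightarrow> ('a set \<Rightarrow> nat) \<Rightarrow> bool" where
  "normal_5_edge_coloring G c \<longleftrightarrow> proper_edge_coloring G 5 c \<and>
     (\<forall>e\<in>edges G. rich_edge G c e \<or> poor_edge G c e)"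


section \<open>Petersen colorings\<close>

definition petersen_coloring :: "'a ugraph \<Rightarrow> ('a set \<Rightarrow> nat set set) \<Rightarrow> bool" where
  "petersen_coloring G \<xi> \<longleftrightarrow> \<xi> ` edges G \<subseteq> edges petersen_graph \<and>
     (\<forall>e\<in>edges G. \<forall>f\<in>adjacent_edges G e. \<xi> f \<in> adjacent_edges petersen_graph (\<xi> e))"

text \<open>For a Petersen coloring of a cubic graph the vertex below exists and is unique;
  see \<open>induced_vertex_map_welldefined\<close>.\<close>

definition induced_vertex_map :: "'a ugraph \<Rightarrow> ('a set \<Rightarrow> nat set set) \<Rightarrow> 'a \<Rightarrow> nat set" where
  "induced_vertex_map G \<xi> v =
     (THE w. w \<in> verts petersen_graph \<and> \<xi> ` edges_at G v = edges_at petersen_graph w)"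

lemma petersen_edges_at:
  assumes "A \<in> verts petersen_graph"
  shows "edges_at petersen_graph A = (\<lambda>B. {A, B}) ` {B. B \<subseteq> {..<5} - A \<and> card B = 2}"
proof (intro equalityI subsetI)
  fix e assume "e \<in> edges_at petersen_graph A"
  then obtain X Y where XY: "e = {X, Y}" "A = X \<or> A = Y"
    "X \<subseteq> {..<5}" "card X = 2" "Y \<subseteq> {..<5}" "card Y = 2" "X \<inter> Y = {}"
    unfolding edges_at_def petersen_graph_def by auto
  then have "(X = A \<and> Y \<subseteq> {..<5} - A) \<or> (Y = A \<and> X \<subseteq> {..<5} - A)" by blast
  then show "e \<in> (\<lambda>B. {A, B}) ` {B. B \<subseteq> {..<5} - A \<and> card B = 2}"
    using XY by (metis (mono_tags, lifting) image_eqI insert_commute mem_Collect_eq)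
next
  fix e assume "e \<in> (\<lambda>B. {A, B}) ` {B. B \<subseteq> {..<5} - A \<and> card B = 2}"
  then obtain B where B: "e = {A, B}" "B \<subseteq> {..<5} - A" "card B = 2" by blast
  have "B \<subseteq> {..<5}" "A \<inter> B = {}" using B by blast+
  moreover have "A \<subseteq> {..<5}" "card A = 2" using assms by (simp_all add: petersen_graph_def)
  ultimately have "e \<in> edges petersen_graph" using B by (auto simp: petersen_graph_def)
  then show "e \<in> edges_at petersen_graph A" using B by (simp add: edges_at_def)
qed

lemma petersen_edgeD:
  assumes "{A, B} \<in> edges petersen_graph"
  shows "A \<subseteq> {..<5}" "card A = 2" "B \<subseteq> {..<5}" "card B = 2" "A \<inter> B = {}"
proof -
  obtain X Y where "{A, B} = {X, Y}" and XY: "X \<subseteq> {..<5}" "card X = 2"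
      "Y \<subseteq> {..<5}" "card Y = 2" "X \<inter> Y = {}"
    using assms unfolding petersen_graph_def by auto
  then have "A = X \<and> B = Y \<or> A = Y \<and> B = X" by (simp add: doubleton_eq_iff)
  with XY show "A \<subseteq> {..<5}" "card A = 2" "B \<subseteq> {..<5}" "card B = 2" "A \<inter> B = {}" by blast+
qed

lemma petersen_edge_card:
  assumes "e \<in> edges petersen_graph"
  shows "e \<subseteq> verts petersen_graph" "card e = 2"
proof -
  obtain A B where e: "e = {A, B}" using assms by (auto simp: petersen_graph_def)
  note D = petersen_edgeD[OF assms[unfolded e]]
  have "A \<noteq> B" using D by auto
  then show "card e = 2" using e by simp
  show "e \<subseteq> verts petersen_graph" using e D by (auto simp: petersen_graph_def)
qed

lemma cubic_petersen_graph: "cubic_graph petersen_graph"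
proof -
  have V: "verts petersen_graph = {A. A \<subseteq> {..<5} \<and> card A = 2}"
    by (simp add: petersen_graph_def)
  have "finite (verts petersen_graph)"
    unfolding V by (rule finite_subset[of _ "Pow {..<5}"]) auto
  moreover have "{0, 1} \<in> verts petersen_graph" unfolding V by auto
  moreover have "card (edges_at petersen_graph A) = 3" if A: "A \<in> verts petersen_graph" for A
  proof -
    have "finite A" using A unfolding V by (auto intro: finite_subset)
    then have c: "card ({..<5} - A) = 3" using A unfolding V by (simp add: card_Diff_subset)
    have "card (edges_at petersen_graph A) = card {B. B \<subseteq> {..<5} - A \<and> card B = 2}"
      unfolding petersen_edges_at[OF A]
      by (rule card_image) (auto simp: inj_on_def doubleton_eq_iff)
    also have "\<dots> = 3" using n_subsets[of "{..<5} - A" 2] c by (simp add: choose_two)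
    finally show ?thesis .
  qed
  ultimately show ?thesis
    unfolding cubic_graph_def simple_graph_def using petersen_edge_card by blast
qed

lemma petersen_no_triangle:
  assumes "{A, B} \<in> edges petersen_graph" "{B, C} \<in> edges petersen_graph"
    "{A, C} \<in> edges petersen_graph"
  shows False
proof -
  note D = petersen_edgeD[OF assms(1)] petersen_edgeD[OF assms(2)] petersen_edgeD[OF assms(3)]
  have fin: "finite A" "finite B" "finite C" using D by (auto intro: finite_subset)
  have "card (A \<union> B \<union> C) = card (A \<union> B) + card C"
    by (rule card_Un_disjoint) (use fin D in auto)
  moreover have "card (A \<union> B) = card A + card B"
    by (rule card_Un_disjoint) (use fin D in auto)
  moreover have "card (A \<union> B \<union> C) \<le> card {..<5::nat}"
    by (rule card_mono) (use D in auto)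
  ultimately show False using D by simp
qed

lemma induced_vertex_map_welldefined:
  assumes G: "cubic_graph G" and xi: "petersen_coloring G \<xi>" and v: "v \<in> verts G"
  shows "\<exists>!w. w \<in> verts petersen_graph \<and> \<xi> ` edges_at G v = edges_at petersen_graph w"
proof -
  let ?P = petersen_graph
  have "card (edges_at G v) = 3" using G v by (simp add: cubic_graph_def)
  then obtain e1 e2 e3 where E: "edges_at G v = {e1, e2, e3}"
    and ne: "e1 \<noteq> e2" "e2 \<noteq> e3" "e1 \<noteq> e3" by (auto simp: card_3_iff)
  have "e1 \<in> edges_at G v" "e2 \<in> edges_at G v" "e3 \<in> edges_at G v" using E by auto
  then have mem: "e1 \<in> edges G" "e2 \<in> edges G" "e3 \<in> edges G" "v \<in> e1" "v \<in> e2" "v \<in> e3"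
    by (auto simp: edges_at_def)
  have adj: "\<xi> f \<noteq> \<xi> e \<and> \<xi> f \<inter> \<xi> e \<noteq> {} \<and> \<xi> e \<in> edges ?P \<and> \<xi> f \<in> edges ?P"
    if "e \<in> edges G" "f \<in> edges G" "v \<in> e" "v \<in> f" "f \<noteq> e" for e f
  proof -
    have "f \<in> adjacent_edges G e" using that by (auto simp: adjacent_edges_def)
    then show ?thesis using xi that by (auto simp: petersen_coloring_def adjacent_edges_def)
  qed
  note a12 = adj[OF mem(1) mem(2) mem(4) mem(5) ne(1)[symmetric]]
  note a13 = adj[OF mem(1) mem(3) mem(4) mem(6) ne(3)[symmetric]]
  note a23 = adj[OF mem(2) mem(3) mem(5) mem(6) ne(2)[symmetric]]
  obtain w where w: "w \<in> \<xi> e1" "w \<in> \<xi> e2" using a12 by blast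
  have ex_other: "\<exists>a. e = {x, a} \<and> a \<noteq> x" if "e \<in> edges ?P" "x \<in> e" for e x
    using petersen_edge_card(2)[OF that(1)] that(2) by (auto simp: card_2_iff doubleton_eq_iff)
  obtain a where a: "\<xi> e1 = {w, a}" using ex_other[of "\<xi> e1" w] w a12 by auto
  obtain b where b: "\<xi> e2 = {w, b}" using ex_other[of "\<xi> e2" w] w a12 by auto
  have ab: "a \<noteq> b" using a b a12 by auto
  have w3: "w \<in> \<xi> e3"
  proof (rule ccontr)
    assume n: "w \<notin> \<xi> e3"
    have a3: "a \<in> \<xi> e3" using a a13 n by fastforce
    have b3: "b \<in> \<xi> e3" using b a23 n by fastforce
    obtain d where "\<xi> e3 = {a, d}" using ex_other[of "\<xi> e3" a] a3 a13 by auto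
    then have e3: "\<xi> e3 = {a, b}" using b3 ab by simp
    show False
    proof (rule petersen_no_triangle)
      show "{w, a} \<in> edges ?P" using a a12 by simp
      show "{a, b} \<in> edges ?P" using e3 a13 by simp
      show "{w, b} \<in> edges ?P" using b a12 by simp
    qed
  qed
  have wV: "w \<in> verts ?P" using petersen_edge_card(1)[of "\<xi> e1"] w a12 by auto
  have sub: "\<xi> ` edges_at G v \<subseteq> edges_at ?P w"
    using E w w3 a12 a13 by (auto simp: edges_at_def)
  have "\<xi> e1 \<noteq> \<xi> e2" "\<xi> e1 \<noteq> \<xi> e3" "\<xi> e2 \<noteq> \<xi> e3" using a12 a13 a23 by auto
  then have c3: "card (\<xi> ` edges_at G v) = 3" using E by simp
  have cw: "card (edges_at ?P w) = 3" using cubic_petersen_graph wV by (simp add: cubic_graph_def)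
  have eq: "\<xi> ` edges_at G v = edges_at ?P w"
  proof (rule card_subset_eq[OF _ sub])
    show "finite (edges_at ?P w)" using cw by (metis card.infinite zero_neq_numeral)
  qed (use c3 cw in simp)
  show ?thesis
  proof (rule ex1I[of _ w])
    show "w \<in> verts ?P \<and> \<xi> ` edges_at G v = edges_at ?P w" using wV eq by simp
  next
    fix x assume "x \<in> verts ?P \<and> \<xi> ` edges_at G v = edges_at ?P x"
    then have "\<xi> e1 \<in> edges_at ?P x" "\<xi> e2 \<in> edges_at ?P x" using E by auto
    then have "x \<in> \<xi> e1" "x \<in> \<xi> e2" by (simp_all add: edges_at_def)
    then show "x = w" using a b ab by auto
  qed
qed

definition petersen_coloring_hom :: "'a ugraph \<Rightarrow> ('a set \<Rightarrow> nat set set) \<Rightarrow> bool" where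
  "petersen_coloring_hom G \<xi> \<longleftrightarrow> petersen_coloring G \<xi> \<and>
     (\<forall>u v. {u, v} \<in> edges G \<longrightarrow>
        {induced_vertex_map G \<xi> u, induced_vertex_map G \<xi> v} \<in> edges petersen_graph)"

end

theory Submission imports Defs begin

text \<open>A proper coloring is strong iff the color sets of any two adjacent vertices meet only in the
  color of the joining edge. With five colors this says that the sets of the two colors missing at
  the two ends of an edge are disjoint, so that sending a vertex to its missing pair is a
  homomorphism to the Kneser graph \<open>P\<close>. Conversely, a covering pulls back the coloring of \<open>P\<close> in
  which the edge \<open>{A, B}\<close> receives the only color outside \<open>A \<union> B\<close>. Surjectivity of a locally
  bijective homomorphism comes from the connectedness of \<open>P\<close>.\<close>

section \<open>Edges and their ends in simple and cubic graphs\<close>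

lemma simple_graph_edgeE:
  assumes "simple_graph G" "e \<in> edges G"
  obtains u v where "e = {u, v}" "u \<noteq> v" "u \<in> verts G" "v \<in> verts G"
  using assms unfolding simple_graph_def card_2_iff by (metis insert_subset)

lemma simple_graph_edge_at:
  assumes "simple_graph G" "e \<in> edges G" "v \<in> e"
  obtains u where "e = {v, u}" "u \<noteq> v" "u \<in> verts G" "v \<in> verts G"
proof -
  obtain x y where "e = {x, y}" "x \<noteq> y" "x \<in> verts G" "y \<in> verts G"
    using simple_graph_edgeE[OF assms(1,2)] .
  then show thesis using assms(3) that[of x] that[of y] by (auto simp: insert_commute)
qed

lemma simple_graph_finite_edges: "simple_graph G \<Longrightarrow> finite (edges G)"
  by (rule finite_subset[of _ "Pow (verts G)"]) (auto simp: simple_graph_def)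

lemma cubic_graph_simple: "cubic_graph G \<Longrightarrow> simple_graph G"
  by (simp add: cubic_graph_def)

lemma cubic_graph_card_edges_at: "cubic_graph G \<Longrightarrow> v \<in> verts G \<Longrightarrow> card (edges_at G v) = 3"
  by (simp add: cubic_graph_def)

lemma cubic_graph_finite_edges_at: "cubic_graph G \<Longrightarrow> finite (edges_at G v)"
  by (simp add: edges_at_def simple_graph_finite_edges cubic_graph_simple)

lemma proper_edge_coloringD:
  assumes "proper_edge_coloring G k c" "e \<in> edges G" "f \<in> edges G" "v \<in> e" "v \<in> f" "c e = c f"
  shows "e = f"
  using assms unfolding proper_edge_coloring_def adjacent_edges_def by blast

section \<open>Strong colorings as proper colorings with only rich edges\<close>

text \<open>Consecutive edges of a path differ in color under a proper coloring, so a path of three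
  edges is bichromatic exactly when its two outer edges agree. These are two edges adjacent to the
  middle edge, and their agreement is what richness of the middle edge forbids.\<close>

lemma strong_edge_coloring_iff_rich:
  assumes G: "simple_graph G"
  shows "strong_edge_coloring G k c \<longleftrightarrow>
    proper_edge_coloring G k c \<and> (\<forall>e\<in>edges G. rich_edge G c e)"
proof (intro iffI conjI ballI)
  assume S: "strong_edge_coloring G k c"
  then show P: "proper_edge_coloring G k c" by (simp add: strong_edge_coloring_def)
  fix e assume e: "e \<in> edges G"
  show "rich_edge G c e"
    unfolding rich_edge_def
  proof (rule inj_onI, rule ccontr)
    fix f g assume fg: "f \<in> adjacent_edges G e" "g \<in> adjacent_edges G e" "c f = c g" "f \<noteq> g"
    then have E: "f \<in> edges G" "g \<in> edges G" "f \<noteq> e" "g \<noteq> e" by (auto simp: adjacent_edges_def)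
    \<comment> \<open>By properness, equally colored distinct edges share no vertex. Hence
      \<open>f\<close> and \<open>g\<close> meet \<open>e\<close> at different ends, and their outer
      ends are distinct, so that \<open>f\<close>, \<open>e\<close>, \<open>g\<close> form a path
      and not a triangle.\<close>
    have disj: "f \<inter> g = {}" using proper_edge_coloringD[OF P E(1,2)] fg by blast
    obtain v where v: "v \<in> f" "v \<in> e" using fg(1) by (auto simp: adjacent_edges_def)
    obtain w where w: "w \<in> g" "w \<in> e" using fg(2) by (auto simp: adjacent_edges_def)
    have "v \<noteq> w" using v w disj by auto
    then have e_eq: "e = {v, w}"
      using simple_graph_edge_at[OF G e v(2)] w(2) by (metis insertE singletonD)
    obtain u where u: "f = {v, u}" "u \<noteq> v" using simple_graph_edge_at[OF G E(1) v(1)] .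
    obtain x where x: "g = {w, x}" "x \<noteq> w" using simple_graph_edge_at[OF G E(2) w(1)] .
    have "c f \<noteq> c e" using proper_edge_coloringD[OF P E(1) e v(1,2)] E(3) by blast
    then have "card {c f, c e, c g} = 2" using fg(3) by (simp add: insert_commute)
    moreover have f_eq: "f = {u, v}" using u by auto
    moreover have "u \<noteq> w" using E(3) u e_eq by auto
    moreover have "x \<noteq> v" using E(4) x e_eq by auto
    moreover have "u \<noteq> x" using f_eq x disj by blast
    ultimately have "bichromatic_path3 G c u v w x"
      using e E(1,2) u(2) x \<open>v \<noteq> w\<close> e_eq by (simp add: bichromatic_path3_def)
    then show False using S by (auto simp: strong_edge_coloring_def)
  qed
next
  assume A: "proper_edge_coloring G k c \<and> (\<forall>e\<in>edges G. rich_edge G c e)"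
  have "\<not> bichromatic_path3 G c u v w x" for u v w x
  proof
    assume "bichromatic_path3 G c u v w x"
    then have d: "distinct [u, v, w, x]" and E: "{u, v} \<in> edges G" "{v, w} \<in> edges G" "{w, x} \<in> edges G"
      and card: "card {c {u, v}, c {v, w}, c {w, x}} = 2"
      by (auto simp: bichromatic_path3_def)
    have ne: "{u, v} \<noteq> {v, w}" "{v, w} \<noteq> {w, x}" "{u, v} \<noteq> {w, x}"
      using d by (auto simp: doubleton_eq_iff)
    have "c {u, v} \<noteq> c {v, w}" "c {v, w} \<noteq> c {w, x}"
      using A proper_edge_coloringD[OF _ E(1,2), of k c v] proper_edge_coloringD[OF _ E(2,3), of k c w] ne
      by auto
    then have "c {u, v} = c {w, x}"
      using card by (auto simp: card_insert_if split: if_splits)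
    moreover have "{u, v} \<in> adjacent_edges G {v, w}" "{w, x} \<in> adjacent_edges G {v, w}"
      using E ne by (auto simp: adjacent_edges_def)
    ultimately show False using A E(2) ne(3) by (auto simp: rich_edge_def dest: inj_onD)
  qed
  with A show "strong_edge_coloring G k c" by (auto simp: strong_edge_coloring_def)
qed

lemma card_colors_at:
  assumes "cubic_graph G" "proper_edge_coloring G k c" "v \<in> verts G"
  shows "card (c ` edges_at G v) = 3"
proof -
  have "inj_on c (edges_at G v)"
    using proper_edge_coloringD[OF assms(2)] by (auto simp: inj_on_def edges_at_def)
  then show ?thesis using cubic_graph_card_edges_at[OF assms(1,3)] by (simp add: card_image)
qed

lemma colors_at_subset:
  assumes "proper_edge_coloring G k c"
  shows "c ` edges_at G v \<subseteq> {..<k}"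
  using assms by (auto simp: proper_edge_coloring_def edges_at_def)

text \<open>Any other common color would occur on an edge \<open>f\<close> at \<open>u\<close> and
  an edge \<open>g\<close> at \<open>v\<close>, both adjacent to the joining edge. Richness gives
  \<open>f = g\<close>, an edge through \<open>u\<close> and \<open>v\<close>, which is the joining
  edge itself.\<close>

lemma colors_at_Int:
  assumes P: "proper_edge_coloring G k c" and e: "{u, v} \<in> edges G" and R: "rich_edge G c {u, v}"
    and G: "simple_graph G"
  shows "c ` edges_at G u \<inter> c ` edges_at G v = {c {u, v}}"
proof (intro equalityI subsetI)
  fix i assume "i \<in> c ` edges_at G u \<inter> c ` edges_at G v"
  then obtain f g where f: "f \<in> edges G" "u \<in> f" "i = c f" and g: "g \<in> edges G" "v \<in> g" "i = c g"
    by (auto simp: edges_at_def)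
  show "i \<in> {c {u, v}}"
  proof (rule ccontr)
    assume "i \<notin> {c {u, v}}"
    then have ne: "f \<noteq> {u, v}" "g \<noteq> {u, v}" using f g by auto
    then have "f \<in> adjacent_edges G {u, v}" "g \<in> adjacent_edges G {u, v}"
      using f g by (auto simp: adjacent_edges_def)
    then have "f = g" using R f g by (auto simp: rich_edge_def dest: inj_onD)
    moreover have "u \<noteq> v" using G e by (auto simp: simple_graph_def)
    ultimately show False
      using simple_graph_edge_at[OF G f(1,2)] g(2) ne(1) by (metis insertE singletonD)
  qed
next
  fix i assume "i \<in> {c {u, v}}"
  then show "i \<in> c ` edges_at G u \<inter> c ` edges_at G v" using e by (auto simp: edges_at_def)
qed

section \<open>The strong chromatic index of a cubic graph\<close>

text \<open>The three colors at one end of an edge and the three at the other end share exactly one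
  color, so 3 + 3 - 1 = 5 colors already occur around a single edge.\<close>

lemma strong_edge_coloring_ge_5:
  assumes G: "cubic_graph G" and c: "strong_edge_coloring G k c"
  shows "5 \<le> k"
proof -
  note S = cubic_graph_simple[OF G]
  have P: "proper_edge_coloring G k c" and R: "\<forall>e\<in>edges G. rich_edge G c e"
    using c strong_edge_coloring_iff_rich[OF S] by auto
  obtain w where w: "w \<in> verts G" using S by (auto simp: simple_graph_def)
  have "edges_at G w \<noteq> {}" using cubic_graph_card_edges_at[OF G w] by auto
  then obtain e where e: "e \<in> edges G" by (auto simp: edges_at_def)
  obtain u v where uv: "e = {u, v}" "u \<in> verts G" "v \<in> verts G" using simple_graph_edgeE[OF S e] .
  let ?U = "c ` edges_at G u" and ?V = "c ` edges_at G v"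
  have "card (?U \<union> ?V) + card (?U \<inter> ?V) = card ?U + card ?V"
    using card_Un_Int[of ?U ?V] cubic_graph_finite_edges_at[OF G] by simp
  moreover have "card (?U \<inter> ?V) = 1" using colors_at_Int[OF P _ _ S] e R uv by simp
  ultimately have "card (?U \<union> ?V) = 5" using card_colors_at[OF G P] uv by simp
  moreover have "card (?U \<union> ?V) \<le> card {..<k}"
    by (rule card_mono) (use colors_at_subset[OF P] in auto)
  ultimately show ?thesis by simp
qed

text \<open>Giving all edges different colors makes every edge rich. This ensures that the
  \<open>LEAST\<close> in \<open>strong_chromatic_index\<close> is attained.\<close>

lemma strong_edge_coloring_exists:
  assumes G: "simple_graph G"
  shows "\<exists>k c. strong_edge_coloring G k c"
proof -
  obtain c :: "'a set \<Rightarrow> nat" and n where c: "c ` edges G = {i. i < n}" "inj_on c (edges G)"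
    using finite_imp_inj_to_nat_seg[OF simple_graph_finite_edges[OF G]] by blast
  have "proper_edge_coloring G n c"
    using c by (auto simp: proper_edge_coloring_def adjacent_edges_def dest: inj_onD)
  moreover have "rich_edge G c e" for e
    unfolding rich_edge_def by (rule inj_on_subset[OF c(2)]) (auto simp: adjacent_edges_def)
  ultimately show ?thesis using strong_edge_coloring_iff_rich[OF G] by blast
qed

lemma strong_chromatic_index_eq_5_iff:
  assumes G: "cubic_graph G"
  shows "strong_chromatic_index G = 5 \<longleftrightarrow> (\<exists>c. strong_edge_coloring G 5 c)"
proof
  assume "strong_chromatic_index G = 5"
  then show "\<exists>c. strong_edge_coloring G 5 c"
    using LeastI_ex[OF strong_edge_coloring_exists[OF cubic_graph_simple[OF G]]]
    unfolding strong_chromatic_index_def by simp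
next
  assume "\<exists>c. strong_edge_coloring G 5 c"
  then show "strong_chromatic_index G = 5"
    unfolding strong_chromatic_index_def
    by (rule Least_equality) (use strong_edge_coloring_ge_5[OF G] in blast)
qed

section \<open>Adjacency and connectedness of the Petersen graph\<close>

lemma petersen_verts_iff: "A \<in> verts petersen_graph \<longleftrightarrow> A \<subseteq> {..<5} \<and> card A = 2"
  by (simp add: petersen_graph_def)

lemma petersen_edge_iff:
  "{A, B} \<in> edges petersen_graph \<longleftrightarrow>
     A \<in> verts petersen_graph \<and> B \<in> verts petersen_graph \<and> A \<inter> B = {}"
proof
  assume "{A, B} \<in> edges petersen_graph"
  then show "A \<in> verts petersen_graph \<and> B \<in> verts petersen_graph \<and> A \<inter> B = {}"
    using petersen_edgeD by (simp add: petersen_verts_iff)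
next
  assume "A \<in> verts petersen_graph \<and> B \<in> verts petersen_graph \<and> A \<inter> B = {}"
  then show "{A, B} \<in> edges petersen_graph"
    by (auto simp: petersen_graph_def)
qed

text \<open>\<open>P\<close> has diameter two: distinct 2-subsets \<open>A\<close> and
  \<open>B\<close> that meet have a union of size 3, and the complement of this union is a common
  neighbor. A nonempty set closed under neighbors therefore reaches every vertex in at most two
  steps.\<close>

lemma petersen_connected:
  assumes W: "W \<subseteq> verts petersen_graph" "W \<noteq> {}"
    and closed: "\<And>A B. A \<in> W \<Longrightarrow> {A, B} \<in> edges petersen_graph \<Longrightarrow> B \<in> W"
  shows "W = verts petersen_graph"
proof (rule equalityI[OF W(1)], rule subsetI)
  fix B assume B: "B \<in> verts petersen_graph"
  obtain A where A: "A \<in> W" using W(2) by auto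
  then have AV: "A \<in> verts petersen_graph" using W(1) by auto
  have fin: "finite A" "finite B"
    using AV B by (auto simp: petersen_verts_iff intro: finite_subset)
  have sum: "card (A \<union> B) + card (A \<inter> B) = 4"
    using card_Un_Int[OF fin] AV B by (simp add: petersen_verts_iff)
  have le: "card (A \<inter> B) \<le> 2"
    using card_mono[of A "A \<inter> B"] fin AV by (simp add: petersen_verts_iff)
  show "B \<in> W"
  proof (cases "A = B \<or> A \<inter> B = {}")
    case True
    then show ?thesis using A AV B closed petersen_edge_iff by blast
  next
    case False
    then have "card (A \<inter> B) \<noteq> 0" using fin by simp
    moreover have "card (A \<inter> B) \<noteq> 2"
    proof
      assume "card (A \<inter> B) = 2"
      then have "A \<inter> B = A" "A \<inter> B = B"
        using card_subset_eq[OF fin(1), of "A \<inter> B"] card_subset_eq[OF fin(2), of "A \<inter> B"] AV B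
        by (simp_all add: petersen_verts_iff)
      then show False using False by blast
    qed
    ultimately have "card (A \<union> B) = 3" using sum le by linarith
    moreover have "A \<union> B \<subseteq> {..<5}" using AV B by (simp add: petersen_verts_iff)
    ultimately have C: "{..<5} - (A \<union> B) \<in> verts petersen_graph"
      using fin by (simp add: petersen_verts_iff card_Diff_subset)
    have "{..<5} - (A \<union> B) \<in> W"
      by (rule closed[OF A]) (use C AV petersen_edge_iff in blast)
    then show ?thesis by (rule closed) (use C B petersen_edge_iff in blast)
  qed
qed

text \<open>Every edge of \<open>P\<close> at \<open>f v\<close> lifts to an edge at
  \<open>v\<close>, so the image of \<open>f\<close> is closed under neighbors, and connectedness of
  \<open>P\<close> makes it everything.\<close>

lemma locally_bijective_petersen_hom_covering:
  assumes G: "simple_graph G" and hom: "graph_hom G petersen_graph f"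
    and bij: "\<And>v. v \<in> verts G \<Longrightarrow>
      bij_betw (\<lambda>e. f ` e) (edges_at G v) (edges_at petersen_graph (f v))"
  shows "covering_map G petersen_graph f"
proof -
  have "f ` verts G = verts petersen_graph"
  proof (rule petersen_connected)
    show "f ` verts G \<subseteq> verts petersen_graph" using hom by (simp add: graph_hom_def)
    show "f ` verts G \<noteq> {}" using G by (simp add: simple_graph_def)
    fix A B assume A: "A \<in> f ` verts G" and AB: "{A, B} \<in> edges petersen_graph"
    then obtain v where v: "v \<in> verts G" "A = f v" by auto
    have "{A, B} \<in> edges_at petersen_graph (f v)" using AB v by (simp add: edges_at_def)
    then obtain e where e: "e \<in> edges_at G v" "{A, B} = f ` e"
      unfolding bij_betw_imp_surj_on[OF bij[OF v(1)], symmetric] by (rule imageE)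
    have "e \<subseteq> verts G" using e(1) G by (auto simp: simple_graph_def edges_at_def)
    moreover have "B \<in> f ` e" by (simp flip: e(2))
    ultimately show "B \<in> f ` verts G" by (meson image_mono subsetD)
  qed
  then show ?thesis using hom bij by (simp add: covering_map_def)
qed

section \<open>From strong colorings to coverings\<close>

text \<open>Local bijectivity holds because a neighbor \<open>x\<close> of \<open>v\<close> is sent
  to the colors at \<open>v\<close> other than that of \<open>{v, x}\<close>. The image of
  \<open>x\<close> thus determines the color of the edge, and the color determines the edge among
  those at \<open>v\<close>. Both graphs have three edges at each vertex, so injectivity
  suffices.\<close>

lemma strong_5_edge_coloring_covering:
  assumes G: "cubic_graph G" and c: "strong_edge_coloring G 5 c"
  shows "covering_map G petersen_graph (\<lambda>v. {..<5} - c ` edges_at G v)"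
    (is "covering_map G ?P ?T")
proof (rule locally_bijective_petersen_hom_covering)
  show S: "simple_graph G" using cubic_graph_simple[OF G] .
  have P: "proper_edge_coloring G 5 c" and R: "\<forall>e\<in>edges G. rich_edge G c e"
    using c strong_edge_coloring_iff_rich[OF S] by auto
  note fin = cubic_graph_finite_edges_at[OF G]
  have TV: "?T v \<in> verts ?P" if "v \<in> verts G" for v
    using card_colors_at[OF G P that] colors_at_subset[OF P, of v] fin
    by (simp add: petersen_verts_iff card_Diff_subset)
  have TE: "{?T u, ?T v} \<in> edges ?P" and T_eq: "?T v = c ` edges_at G u - {c {u, v}}"
    if e: "{u, v} \<in> edges G" for u v
  proof -
    have uv: "u \<in> verts G" "v \<in> verts G" using e S by (auto simp: simple_graph_def)
    let ?U = "c ` edges_at G u" and ?V = "c ` edges_at G v"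
    have I: "?U \<inter> ?V = {c {u, v}}" using colors_at_Int[OF P e _ S] R e by blast
    have "card (?U \<union> ?V) + card (?U \<inter> ?V) = 6"
      using card_Un_Int[of ?U ?V] fin card_colors_at[OF G P] uv by simp
    then have "card (?U \<union> ?V) = card {..<5::nat}" using I by simp
    \<comment> \<open>All five colors occur around the edge, so whatever is missing at one end is
      present at the other.\<close>
    then have "?U \<union> ?V = {..<5}"
      using colors_at_subset[OF P] by (intro card_subset_eq) auto
    then show "{?T u, ?T v} \<in> edges ?P" "?T v = ?U - {c {u, v}}"
      using I TV[OF uv(1)] TV[OF uv(2)] unfolding petersen_edge_iff by blast+
  qed
  show hom: "graph_hom G ?P ?T" using TV TE by (auto simp: graph_hom_def)
  fix v assume v: "v \<in> verts G"
  have inj: "inj_on (\<lambda>e. ?T ` e) (edges_at G v)"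
  proof (rule inj_onI)
    fix e g assume "e \<in> edges_at G v" "g \<in> edges_at G v" and eq: "?T ` e = ?T ` g"
    then have e: "e \<in> edges G" "v \<in> e" and g: "g \<in> edges G" "v \<in> g" by (auto simp: edges_at_def)
    obtain x where x: "e = {v, x}" using simple_graph_edge_at[OF S e] .
    obtain y where y: "g = {v, y}" using simple_graph_edge_at[OF S g] .
    have "{?T v, ?T x} = {?T v, ?T y}" using eq x y by simp
    then have "?T x = ?T y" by (metis doubleton_eq_iff)
    then have "c ` edges_at G v - {c e} = c ` edges_at G v - {c g}"
      using T_eq[of v x] T_eq[of v y] e g x y by simp
    \<comment> \<open>Both removed colors belong to the set they are removed from, so equal
      remainders force equal removed colors.\<close>
    moreover have "c e \<in> c ` edges_at G v" "c g \<in> c ` edges_at G v"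
      using e g by (auto simp: edges_at_def)
    ultimately have "c e = c g" by blast
    then show "e = g" using proper_edge_coloringD[OF P e(1) g(1) e(2) g(2)] by simp
  qed
  moreover have "(\<lambda>e. ?T ` e) ` edges_at G v = edges_at ?P (?T v)"
  proof (rule card_subset_eq)
    show "finite (edges_at ?P (?T v))" using cubic_graph_finite_edges_at[OF cubic_petersen_graph] .
    show "(\<lambda>e. ?T ` e) ` edges_at G v \<subseteq> edges_at ?P (?T v)"
    proof
      fix E assume "E \<in> (\<lambda>e. ?T ` e) ` edges_at G v"
      then obtain e where e: "e \<in> edges G" "v \<in> e" "E = ?T ` e" by (auto simp: edges_at_def)
      obtain x where "e = {v, x}" using simple_graph_edge_at[OF S e(1,2)] .
      then show "E \<in> edges_at ?P (?T v)" using TE[of v x] e by (simp add: edges_at_def)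
    qed
    show "card ((\<lambda>e. ?T ` e) ` edges_at G v) = card (edges_at ?P (?T v))"
      using card_image[OF inj] cubic_graph_card_edges_at[OF G v]
        cubic_graph_card_edges_at[OF cubic_petersen_graph TV[OF v]] by simp
  qed
  ultimately show "bij_betw (\<lambda>e. ?T ` e) (edges_at G v) (edges_at ?P (?T v))"
    by (simp add: bij_betw_def)
qed

section \<open>From coverings to strong colorings\<close>

text \<open>Taking the union over \<open>E\<close> lets the color be read off the image of an edge
  without naming its ends. The value of \<open>the_elem\<close> is meaningful on edges of
  \<open>P\<close>, where two disjoint pairs leave a single element.\<close>

definition petersen_missing_color :: "nat set set \<Rightarrow> nat" where
  "petersen_missing_color E = the_elem ({..<5} - \<Union>E)"

lemma petersen_missing_color:
  assumes "{A, B} \<in> edges petersen_graph"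
  shows "{..<5} - (A \<union> B) = {petersen_missing_color {A, B}}"
proof -
  note D = petersen_edgeD[OF assms]
  have fin: "finite A" "finite B" using D by (auto intro: finite_subset)
  then have "card (A \<union> B) = 4" using D by (simp add: card_Un_disjoint)
  then have "card ({..<5} - (A \<union> B)) = 1" using D fin by (simp add: card_Diff_subset)
  then obtain i where "{..<5} - (A \<union> B) = {i}" by (auto simp: card_1_singleton_iff)
  then show ?thesis by (simp add: petersen_missing_color_def)
qed

lemma covering_map_edge_neq:
  assumes "covering_map G H f" "v \<in> verts G" "e \<in> edges G" "g \<in> edges G" "v \<in> e" "v \<in> g" "e \<noteq> g"
  shows "f ` e \<noteq> f ` g"
proof -
  have "inj_on (\<lambda>e. f ` e) (edges_at G v)"
    using assms(1,2) by (auto simp: covering_map_def bij_betw_def)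
  then show ?thesis using assms by (auto simp: edges_at_def dest: inj_onD)
qed

text \<open>For richness, an edge at \<open>u\<close> has a color outside \<open>f u\<close> and an
  edge at \<open>v\<close> a color outside \<open>f v\<close>. A color common to both lies outside
  \<open>f u \<union> f v\<close>, so it is the color of \<open>{u, v}\<close>, which properness
  excludes for an adjacent edge.\<close>

lemma covering_strong_5_edge_coloring:
  assumes S: "simple_graph G" and f: "covering_map G petersen_graph f"
  shows "strong_edge_coloring G 5 (\<lambda>e. petersen_missing_color (f ` e))"
    (is "strong_edge_coloring G 5 ?c")
proof -
  have col: "{..<5} - (f u \<union> f v) = {?c {u, v}}" if "{u, v} \<in> edges G" for u v
  proof -
    have "{f u, f v} \<in> edges petersen_graph"
      using f that by (auto simp: covering_map_def graph_hom_def)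
    then show ?thesis using petersen_missing_color by simp
  qed
  have neq: "?c e \<noteq> ?c g" if e: "e \<in> edges G" and g: "g \<in> adjacent_edges G e" for e g
  proof
    assume eq: "?c e = ?c g"
    obtain v where v: "v \<in> e" "v \<in> g" and gE: "g \<in> edges G" and ne: "e \<noteq> g"
      using g by (auto simp: adjacent_edges_def)
    obtain x where x: "e = {v, x}" "v \<in> verts G" using simple_graph_edge_at[OF S e v(1)] .
    obtain y where y: "g = {v, y}" using simple_graph_edge_at[OF S gE v(2)] .
    have "f x \<noteq> f y" using covering_map_edge_neq[OF f x(2) e gE v ne] x y by auto
    moreover have "{f v, f x} \<in> edges petersen_graph" "{f v, f y} \<in> edges petersen_graph"
      using f e gE x y by (auto simp: covering_map_def graph_hom_def)
    \<comment> \<open>Inside the complement of \<open>f v\<close>, each of \<open>f x\<close> and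
      \<open>f y\<close> is determined by the color it leaves out. Equal colors would give
      \<open>f x = f y\<close>, against local injectivity.\<close>
    then have "f x \<subseteq> {..<5} - f v" "f y \<subseteq> {..<5} - f v" using petersen_edgeD by blast+
    moreover have "{..<5} - (f v \<union> f x) = {..<5} - (f v \<union> f y)"
      using col[of v x] col[of v y] e gE x y eq by simp
    ultimately show False by blast
  qed
  have "proper_edge_coloring G 5 ?c"
    unfolding proper_edge_coloring_def
  proof (intro conjI ballI subsetI)
    fix i assume "i \<in> ?c ` edges G"
    then obtain e where e: "e \<in> edges G" "i = ?c e" by auto
    obtain u v where "e = {u, v}" using simple_graph_edgeE[OF S e(1)] .
    then show "i \<in> {..<5}" using col[of u v] e by blast
  qed (use neq in auto)
  moreover have "rich_edge G ?c e" if e: "e \<in> edges G" for e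
    unfolding rich_edge_def
  proof (rule inj_onI, rule ccontr)
    fix g h assume g: "g \<in> adjacent_edges G e" and h: "h \<in> adjacent_edges G e"
      and eq: "?c g = ?c h" and ne: "g \<noteq> h"
    have gE: "g \<in> edges G" and hE: "h \<in> edges G" using g h by (auto simp: adjacent_edges_def)
    obtain u where u: "u \<in> g" "u \<in> e" using g by (auto simp: adjacent_edges_def)
    obtain v where v: "v \<in> h" "v \<in> e" using h by (auto simp: adjacent_edges_def)
    have "u \<noteq> v"
    proof
      assume "u = v"
      then have "h \<in> adjacent_edges G g" using u v hE ne by (auto simp: adjacent_edges_def)
      then show False using neq[OF gE] eq by blast
    qed
    then have e_eq: "e = {u, v}"
      using simple_graph_edge_at[OF S e u(2)] v(2) by (metis insertE singletonD)
    obtain x where x: "g = {u, x}" using simple_graph_edge_at[OF S gE u(1)] .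
    obtain y where y: "h = {v, y}" using simple_graph_edge_at[OF S hE v(1)] .
    have "?c g \<in> {..<5} - f u" using col[of u x] gE x by blast
    moreover have "?c h \<in> {..<5} - f v" using col[of v y] hE y by blast
    ultimately have "?c g \<in> {..<5} - (f u \<union> f v)" using eq by simp
    then have "?c g = ?c e" using col[of u v] e e_eq by blast
    then show False using neq[OF e g] by simp
  qed
  ultimately show ?thesis using strong_edge_coloring_iff_rich[OF S] by blast
qed

section \<open>Coverings and Petersen colorings\<close>

text \<open>Local injectivity keeps the images of adjacent edges distinct, and they still share the
  image of the common vertex. Local surjectivity identifies the induced vertex map with
  \<open>f\<close>, which is a homomorphism.\<close>

lemma covering_petersen_coloring_hom:
  assumes G: "cubic_graph G" and f: "covering_map G petersen_graph f"
  shows "petersen_coloring_hom G (\<lambda>e. f ` e)"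
proof -
  let ?P = petersen_graph
  note S = cubic_graph_simple[OF G]
  have bij: "(\<lambda>e. f ` e) ` edges_at G v = edges_at ?P (f v)" if "v \<in> verts G" for v
    using f that by (simp add: covering_map_def bij_betw_def)
  have V: "f v \<in> verts ?P" if "v \<in> verts G" for v
    using f that by (auto simp: covering_map_def graph_hom_def)
  have E: "{f u, f v} \<in> edges ?P" if "{u, v} \<in> edges G" for u v
    using f that by (auto simp: covering_map_def graph_hom_def)
  have xi: "petersen_coloring G (\<lambda>e. f ` e)"
    unfolding petersen_coloring_def
  proof (intro conjI subsetI ballI)
    fix F assume "F \<in> (\<lambda>e. f ` e) ` edges G"
    then obtain e where e: "e \<in> edges G" "F = f ` e" by auto
    obtain u v where "e = {u, v}" using simple_graph_edgeE[OF S e(1)] .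
    then show "F \<in> edges ?P" using e E by auto
  next
    fix e g assume e: "e \<in> edges G" and g: "g \<in> adjacent_edges G e"
    then obtain v where v: "v \<in> e" "v \<in> g" and gE: "g \<in> edges G" and ne: "e \<noteq> g"
      by (auto simp: adjacent_edges_def)
    have vV: "v \<in> verts G" using e v S by (auto simp: simple_graph_def)
    have "f ` g \<in> edges_at ?P (f v)" using bij[OF vV] gE v by (auto simp: edges_at_def)
    then have "f ` g \<in> edges ?P" by (simp add: edges_at_def)
    moreover have "f ` e \<noteq> f ` g" using covering_map_edge_neq[OF f vV e gE v ne] .
    ultimately show "f ` g \<in> adjacent_edges ?P (f ` e)"
      using v by (auto simp: adjacent_edges_def)
  qed
  have ind: "induced_vertex_map G (\<lambda>e. f ` e) v = f v" if v: "v \<in> verts G" for v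
    unfolding induced_vertex_map_def
    \<comment> \<open>\<open>f v\<close> meets the condition that characterizes the induced vertex,
      and that vertex is unique.\<close>
    by (rule the1_equality[OF induced_vertex_map_welldefined[OF G xi v]]) (use V bij v in blast)
  have "{induced_vertex_map G (\<lambda>e. f ` e) u, induced_vertex_map G (\<lambda>e. f ` e) v} \<in> edges ?P"
    if e: "{u, v} \<in> edges G" for u v
  proof -
    have "u \<in> verts G" "v \<in> verts G" using e S by (auto simp: simple_graph_def)
    then show ?thesis using ind E[OF e] by simp
  qed
  then show ?thesis using xi by (simp add: petersen_coloring_hom_def)
qed

text \<open>The homomorphism condition makes \<open>\<xi>\<close> agree on every edge with the
  action of the induced vertex map. The description of \<open>\<xi>\<close> at a vertex then becomes
  local surjectivity of that map.\<close>

lemma petersen_coloring_hom_covering: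
  assumes G: "cubic_graph G" and xi: "petersen_coloring_hom G \<xi>"
  shows "covering_map G petersen_graph (induced_vertex_map G \<xi>)"
    (is "covering_map G ?P ?p")
proof (rule locally_bijective_petersen_hom_covering)
  show S: "simple_graph G" using cubic_graph_simple[OF G] .
  have P: "petersen_coloring G \<xi>" using xi by (simp add: petersen_coloring_hom_def)
  have p: "?p v \<in> verts ?P" "\<xi> ` edges_at G v = edges_at ?P (?p v)" if "v \<in> verts G" for v
    using theI'[OF induced_vertex_map_welldefined[OF G P that]]
    unfolding induced_vertex_map_def by auto
  have E: "{?p u, ?p v} \<in> edges ?P" if "{u, v} \<in> edges G" for u v
    using xi that by (auto simp: petersen_coloring_hom_def)
  show "graph_hom G ?P ?p" using p E by (auto simp: graph_hom_def)
  \<comment> \<open>Two adjacent vertices of \<open>P\<close> lie on only one common edge.\<close>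
  have xi_eq: "?p ` e = \<xi> e" if e: "e \<in> edges G" for e
  proof -
    obtain u v where uv: "e = {u, v}" "u \<in> verts G" "v \<in> verts G" using simple_graph_edgeE[OF S e] .
    have "e \<in> edges_at G u" "e \<in> edges_at G v" using uv e by (auto simp: edges_at_def)
    then have "\<xi> e \<in> edges_at ?P (?p u)" "\<xi> e \<in> edges_at ?P (?p v)"
      using p uv by (metis imageI)+
    then have m: "\<xi> e \<in> edges ?P" "?p u \<in> \<xi> e" "?p v \<in> \<xi> e" by (auto simp: edges_at_def)
    have "card {?p u, ?p v} = 2" using petersen_edge_card(2)[OF E] e uv by simp
    then have "{?p u, ?p v} = \<xi> e"
      using m petersen_edge_card(2)[OF m(1)] by (intro card_subset_eq) (auto intro: card_ge_0_finite)
    then show ?thesis using uv by simp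
  qed
  fix v assume v: "v \<in> verts G"
  have im: "(\<lambda>e. ?p ` e) ` edges_at G v = edges_at ?P (?p v)"
    using p(2)[OF v] xi_eq by (metis (mono_tags, lifting) edges_at_def image_cong mem_Collect_eq)
  \<comment> \<open>A surjection between two sets of three edges is injective.\<close>
  moreover have "inj_on (\<lambda>e. ?p ` e) (edges_at G v)"
    by (rule eq_card_imp_inj_on[OF cubic_graph_finite_edges_at[OF G]])
      (simp add: im cubic_graph_card_edges_at[OF G v]
        cubic_graph_card_edges_at[OF cubic_petersen_graph p(1)[OF v]])
  ultimately show "bij_betw (\<lambda>e. ?p ` e) (edges_at G v) (edges_at ?P (?p v))"
    by (simp add: bij_betw_def)
qed

theorem theorem11:
  fixes G :: "'a ugraph"
  assumes "cubic_graph G"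
  shows "(strong_chromatic_index G = 5 \<longleftrightarrow> covers G petersen_graph) \<and>
         (covers G petersen_graph \<longleftrightarrow>
            (\<exists>c. normal_5_edge_coloring G c \<and> (\<forall>e\<in>edges G. rich_edge G c e))) \<and>
         ((\<exists>c. normal_5_edge_coloring G c \<and> (\<forall>e\<in>edges G. rich_edge G c e)) \<longleftrightarrow>
            (\<exists>\<xi>. petersen_coloring_hom G \<xi>))"
proof -
  note S = cubic_graph_simple[OF assms]
  have "covers G petersen_graph \<longleftrightarrow> (\<exists>c. strong_edge_coloring G 5 c)"
    unfolding covers_def
    using strong_5_edge_coloring_covering[OF assms] covering_strong_5_edge_coloring[OF S] by blast
  \<comment> \<open>Richness of all edges already yields the rich-or-poor condition, so both sides
    reduce to a proper 5-coloring with every edge rich.\<close>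
  moreover have "normal_5_edge_coloring G c \<and> (\<forall>e\<in>edges G. rich_edge G c e) \<longleftrightarrow>
      strong_edge_coloring G 5 c" for c
    unfolding strong_edge_coloring_iff_rich[OF S] normal_5_edge_coloring_def by blast
  moreover have "covers G petersen_graph \<longleftrightarrow> (\<exists>\<xi>. petersen_coloring_hom G \<xi>)"
    unfolding covers_def
    using covering_petersen_coloring_hom[OF assms] petersen_coloring_hom_covering[OF assms] by blast
  ultimately show ?thesis using strong_chromatic_index_eq_5_iff[OF assms] by simp
qed

end
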